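(* Let $0<\rho_o<1$, let $\overline{\mathbb D(0,\rho_o)}=\{z\in\mathbb C:|z|\le\rho_o\}$, with $z=x+iy$, and let $\kappa\in\{1,-1\}$. The solutions $\varphi$ over $\overline{\mathbb D(0,\rho_o)}$ of $$\Delta\varphi+\kappa\,\frac{8\varphi}{\left(1+\kappa(x^2+y^2)\right)^2}=0\qquad\text{and}\qquad \kappa\varphi<0$$ coincide with the functions of the form $$\varphi(z)=\operatorname{Re}\left(F(z)-\frac{2|z|^2}{1+|z|^2}\,\frac1z\int_0^zF(\zeta)\,d\zeta\right)\quad\text{if }\kappa=1,$$ $$\varphi(z)=\operatorname{Re}\left(\frac{1+|z|^2}{1-|z|^2}\,F(z)+z\,\frac{dF(z)}{dz}\right)\quad\text{if }\kappa=-1,$$ for some holomorphic function $F$ constrained just by the sign condition $\kappa\varphi<0$.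
   Context: $\Delta=\partial_x^2+\partial_y^2$ is the Euclidean Laplacian and $\varphi$ is real valued. "Over the closed disk" means that solutions $\varphi$ and holomorphic functions $F$ are defined on a neighbourhood of the closed disk. The expression $\frac1z\int_0^zF(\zeta)d\zeta$ is understood as its holomorphic extension, with value $F(0)$, at $z=0$. *)

theory Defs
  imports "HOL-Complex_Analysis.Complex_Analysis"
begin

definition has_partials_at :: "(complex \<Rightarrow> real) \<Rightarrow> complex \<Rightarrow> bool" where
  "has_partials_at f z \<longleftrightarrow>
     (\<lambda>t::real. f (z + of_real t)) differentiable (at 0) \<and>
     (\<lambda>t::real. f (z + \<i> * of_real t)) differentiable (at 0)"

definition dx :: "(complex \<Rightarrow> real) \<Rightarrow> complex \<Rightarrow> real" where
  "dx f z = deriv (\<lambda>t::real. f (z + of_real t)) 0"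

definition dy :: "(complex \<Rightarrow> real) \<Rightarrow> complex \<Rightarrow> real" where
  "dy f z = deriv (\<lambda>t::real. f (z + \<i> * of_real t)) 0"

definition C1_on :: "complex set \<Rightarrow> (complex \<Rightarrow> real) \<Rightarrow> bool" where
  "C1_on U f \<longleftrightarrow> (\<forall>z\<in>U. has_partials_at f z) \<and> continuous_on U (dx f) \<and> continuous_on U (dy f)"

definition C2_on :: "complex set \<Rightarrow> (complex \<Rightarrow> real) \<Rightarrow> bool" where
  "C2_on U f \<longleftrightarrow> C1_on U f \<and> C1_on U (dx f) \<and> C1_on U (dy f)"

definition laplacian :: "(complex \<Rightarrow> real) \<Rightarrow> complex \<Rightarrow> real" where
  "laplacian f z = dx (dx f) z + dy (dy f) z"

text \<open>The condition \<open>1 + \<kappa> |z|\<^sup>2 \<noteq> 0\<close> keeps the neighbourhood inside the region where the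
  coefficients are defined; without it, the convention \<open>x / 0 = 0\<close> would give the
  equation and the formulas a spurious meaning on the unit circle for \<open>\<kappa> = -1\<close>.\<close>

definition disk_nbhd :: "real \<Rightarrow> real \<Rightarrow> complex set \<Rightarrow> bool" where
  "disk_nbhd \<kappa> \<rho> U \<longleftrightarrow>
     open U \<and> cball 0 \<rho> \<subseteq> U \<and> (\<forall>z\<in>U. 1 + \<kappa> * (cmod z)\<^sup>2 \<noteq> 0)"

text \<open>Functions over the closed disk are represented by total functions, of which only
  the restriction to some neighbourhood of the disk is relevant.\<close>

definition solution_over_disk :: "real \<Rightarrow> real \<Rightarrow> (complex \<Rightarrow> real) \<Rightarrow> bool" where
  "solution_over_disk \<kappa> \<rho> \<phi> \<longleftrightarrow>
     (\<exists>U. disk_nbhd \<kappa> \<rho> U \<and> C2_on U \<phi> \<and>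
        (\<forall>z\<in>U. laplacian \<phi> z + \<kappa> * (8 * \<phi> z / (1 + \<kappa> * ((Re z)\<^sup>2 + (Im z)\<^sup>2))\<^sup>2) = 0 \<and>
               \<kappa> * \<phi> z < 0))"

definition mean_integral :: "(complex \<Rightarrow> complex) \<Rightarrow> complex \<Rightarrow> complex" where
  "mean_integral F z = (if z = 0 then F 0 else 1 / z * contour_integral (linepath 0 z) F)"

definition rep_formula :: "real \<Rightarrow> (complex \<Rightarrow> complex) \<Rightarrow> complex \<Rightarrow> real" where
  "rep_formula \<kappa> F z =
     (if \<kappa> = 1
      then Re (F z - of_real (2 * (cmod z)\<^sup>2 / (1 + (cmod z)\<^sup>2)) * mean_integral F z)
      else Re (of_real ((1 + (cmod z)\<^sup>2) / (1 - (cmod z)\<^sup>2)) * F z + z * deriv F z))"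

end

theory Submission imports Defs begin

text \<open>Write \<open>w = 1 + \<kappa> |z|\<^sup>2\<close>, and let subscripts \<open>z\<close> and \<open>zb\<close> denote the
Wirtinger derivatives, so that the equation reads \<open>\<phi>\<^sub>z\<^sub>z\<^sub>b = - 2 \<kappa> \<phi> / w\<^sup>2\<close>. Both formulas of the theorem are
instances of one:

  \<open>\<phi> = Re (H' - 2 \<kappa> cnj z H / w)\<close>  with \<open>H\<close> holomorphic and \<open>H 0 = 0\<close>,

where \<open>H\<close> is the primitive of \<open>F\<close> for \<open>\<kappa> = 1\<close> and \<open>H z = z F z\<close> for \<open>\<kappa> = -1\<close>
(\<open>rep_formula_pos\<close>, \<open>rep_formula_neg\<close>). That such functions solve the equation is a
computation (\<open>potential_field_solution\<close>).

Conversely, let \<open>\<phi>\<close> be a solution on a disk and put \<open>p = \<phi>\<^sub>z\<close>. For smooth \<open>\<phi>\<close> the equation makes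
\<open>p\<^sub>z + 2 \<kappa> cnj z p / w\<close> holomorphic (it should be \<open>H'''/2\<close>), but showing this directly takes a third
derivative, and \<open>\<phi>\<close> is only \<open>C\<^sup>2\<close>. Instead the equation is used in the form that the one-form
\<open>f dz + g dzb\<close> with \<open>f = 2 \<kappa> cnj z p / w\<close> and \<open>g = 2 \<kappa> \<phi> / w\<^sup>2\<close>, which is only \<open>C\<^sup>1\<close>, is closed; by the
Poincare lemma (\<open>closed_form_exact\<close>) it has a primitive \<open>M\<close>. Since \<open>p\<^sub>z\<^sub>b = - g\<close>, the function
\<open>N = p + M\<close> has vanishing \<open>zb\<close>-derivative, so it is holomorphic, and \<open>N' = p\<^sub>z + 2 \<kappa> cnj z p / w\<close>.
With iterated primitives \<open>N2'' = N1' = N\<close>, the function \<open>w\<^sup>2 N - 2 \<kappa> cnj z w N1 + 2 (cnj z)\<^sup>2 N2\<close> has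
\<open>z\<close>-derivative \<open>w\<^sup>2 N' = (w\<^sup>2 p)\<^sub>z\<close>, so its difference from \<open>w\<^sup>2 p\<close> is the conjugate of a holomorphic
function \<open>B\<close>. Taking the \<open>zb\<close>-derivative and using the equation again expresses \<open>\<phi>\<close> itself, and it
comes out as \<open>Re (H' - 2 \<kappa> cnj z H / w)\<close> with \<open>H = N2 - \<kappa> B / 2\<close> (\<open>solution_potential\<close>). Finally
\<open>a + \<kappa> cnj a z\<^sup>2\<close> contributes nothing to the real part, so that \<open>H 0 = 0\<close> can be arranged
(\<open>potential_vanishing_at_0\<close>).\<close>

section \<open>Wirtinger derivatives\<close>

definition has_wirtinger :: "(complex \<Rightarrow> complex) \<Rightarrow> complex \<Rightarrow> complex \<Rightarrow> complex \<Rightarrow> bool" where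
  "has_wirtinger f a b z \<longleftrightarrow> (f has_derivative (\<lambda>h. a * h + b * cnj h)) (at z)"

lemma has_wirtinger_eq:
  "has_wirtinger f a b z \<Longrightarrow> a = a' \<Longrightarrow> b = b' \<Longrightarrow> has_wirtinger f a' b' z"
  by simp

lemma has_wirtinger_holomorphic:
  assumes "(f has_field_derivative f') (at z)"
  shows "has_wirtinger f f' 0 z"
  using assms by (simp add: has_wirtinger_def has_field_derivative_def)

lemma has_wirtinger_const: "has_wirtinger (\<lambda>_. c) 0 0 z"
  and has_wirtinger_ident: "has_wirtinger (\<lambda>z. z) 1 0 z"
  and has_wirtinger_conj: "has_wirtinger cnj 0 1 z"
  by (auto simp: has_wirtinger_def intro!: derivative_eq_intros)

lemma has_wirtinger_cnj:
  "has_wirtinger f a b z \<Longrightarrow> has_wirtinger (\<lambda>z. cnj (f z)) (cnj b) (cnj a) z"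
  unfolding has_wirtinger_def by (rule has_derivative_eq_rhs[OF has_derivative_cnj]) auto

lemma has_wirtinger_add:
  "has_wirtinger f a b z \<Longrightarrow> has_wirtinger g c d z \<Longrightarrow> has_wirtinger (\<lambda>z. f z + g z) (a + c) (b + d) z"
  unfolding has_wirtinger_def
  by (auto intro!: derivative_eq_intros simp: algebra_simps)

lemma has_wirtinger_diff:
  "has_wirtinger f a b z \<Longrightarrow> has_wirtinger g c d z \<Longrightarrow> has_wirtinger (\<lambda>z. f z - g z) (a - c) (b - d) z"
  unfolding has_wirtinger_def
  by (auto intro!: derivative_eq_intros simp: algebra_simps)

lemma has_wirtinger_mult:
  "has_wirtinger f a b z \<Longrightarrow> has_wirtinger g c d z \<Longrightarrow>
     has_wirtinger (\<lambda>z. f z * g z) (a * g z + f z * c) (b * g z + f z * d) z"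
  unfolding has_wirtinger_def
  by (auto intro!: derivative_eq_intros simp: algebra_simps)

lemma has_wirtinger_divide:
  assumes "has_wirtinger f a b z" "has_wirtinger g c d z" "g z \<noteq> 0"
  shows "has_wirtinger (\<lambda>z. f z / g z) ((a * g z - f z * c) / (g z)\<^sup>2) ((b * g z - f z * d) / (g z)\<^sup>2) z"
proof -
  have "((\<lambda>z. f z / g z) has_derivative
      (\<lambda>h. ((a * h + b * cnj h) * g z - f z * (c * h + d * cnj h)) / (g z * g z))) (at z)"
    using assms unfolding has_wirtinger_def by (intro has_derivative_divide') auto
  then show ?thesis unfolding has_wirtinger_def
    by (rule has_derivative_eq_rhs)
       (auto simp: fun_eq_iff power2_eq_square algebra_simps diff_divide_distrib add_divide_distrib)
qed

lemma has_wirtinger_power2: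
  assumes "has_wirtinger f a b z"
  shows "has_wirtinger (\<lambda>z. (f z)\<^sup>2) (2 * f z * a) (2 * f z * b) z"
  by (rule has_wirtinger_eq[OF has_wirtinger_mult[OF assms assms, folded power2_eq_square]]) simp_all

lemmas has_wirtinger_intros = has_wirtinger_const has_wirtinger_ident has_wirtinger_conj
  has_wirtinger_cnj has_wirtinger_add has_wirtinger_diff has_wirtinger_mult has_wirtinger_divide
  has_wirtinger_power2

lemma has_wirtinger_transform:
  assumes "has_wirtinger f a b z" "open U" "z \<in> U" "\<And>y. y \<in> U \<Longrightarrow> f y = g y"
  shows "has_wirtinger g a b z"
  using assms unfolding has_wirtinger_def by (blast intro: has_derivative_transform_within_open)

lemma has_wirtinger_imp_continuous:
  assumes "\<And>z. z \<in> U \<Longrightarrow> has_wirtinger f (a z) (b z) z"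
  shows "continuous_on U f"
  by (meson assms continuous_at_imp_continuous_on has_derivative_continuous has_wirtinger_def)

lemma has_wirtinger_imp_holomorphic:
  assumes "\<And>z. z \<in> U \<Longrightarrow> has_wirtinger f (f' z) 0 z"
  shows "f holomorphic_on U"
  unfolding holomorphic_on_def
proof
  fix z assume "z \<in> U"
  then have "(f has_field_derivative f' z) (at z)"
    using assms[of z] by (simp add: has_wirtinger_def has_field_derivative_def)
  then show "f field_differentiable at z within U"
    using field_differentiable_def field_differentiable_at_within by blast
qed

lemma has_wirtinger_of_real:
  assumes "(\<phi> has_derivative (\<lambda>h. p * Re h + q * Im h)) (at z)"
  shows "has_wirtinger (\<lambda>z. of_real (\<phi> z)) (Complex (p / 2) (- q / 2)) (Complex (p / 2) (q / 2)) z"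
proof -
  have "((\<lambda>z. of_real (\<phi> z) :: complex) has_derivative (\<lambda>h. of_real (p * Re h + q * Im h))) (at z)"
    using assms by (rule has_derivative_of_real)
  then show ?thesis unfolding has_wirtinger_def
    by (rule has_derivative_eq_rhs) (auto simp: fun_eq_iff complex_eq_iff)
qed

section \<open>Functions with continuous partial derivatives\<close>

lemma has_real_derivative_dx:
  assumes "has_partials_at f (z + of_real s)"
  shows "((\<lambda>t::real. f (z + of_real t)) has_real_derivative dx f (z + of_real s)) (at s)"
proof -
  have "((\<lambda>t::real. f (z + of_real s + of_real t)) has_real_derivative dx f (z + of_real s)) (at 0)"
    using assms unfolding has_partials_at_def dx_def
    by (auto simp: DERIV_deriv_iff_real_differentiable)
  then show ?thesis
    using DERIV_shift[of "\<lambda>t::real. f (z + of_real t)" _ 0 s]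
    by (simp add: add.assoc add.commute add.left_commute)
qed

lemma has_real_derivative_dy:
  assumes "has_partials_at f (z + \<i> * of_real s)"
  shows "((\<lambda>t::real. f (z + \<i> * of_real t)) has_real_derivative dy f (z + \<i> * of_real s)) (at s)"
proof -
  have "((\<lambda>t::real. f (z + \<i> * of_real s + \<i> * of_real t)) has_real_derivative dy f (z + \<i> * of_real s)) (at 0)"
    using assms unfolding has_partials_at_def dy_def
    by (auto simp: DERIV_deriv_iff_real_differentiable)
  then show ?thesis
    using DERIV_shift[of "\<lambda>t::real. f (z + \<i> * of_real t)" _ 0 s]
    by (simp add: algebra_simps)
qed

lemma partials_of_derivative:
  assumes "(f has_derivative D) (at z)"
  shows "has_partials_at f z" "dx f z = D 1" "dy f z = D \<i>"
proof -
  have lin: "D (of_real c * v) = c * D v" for c v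
    using linear_scale[OF has_derivative_linear[OF assms], of c v] by (simp add: scaleR_conv_of_real)
  have *: "((\<lambda>t::real. f (z + v * of_real t)) has_real_derivative D v) (at 0)" for v
  proof -
    have "((\<lambda>t::real. f (z + v * of_real t)) has_derivative (\<lambda>h. D (v * of_real h))) (at 0)"
      by (rule has_derivative_compose[where g=f and f="\<lambda>t. z + v * of_real t", OF _ ])
         (auto intro!: derivative_eq_intros simp: assms)
    then show ?thesis
      by (rule has_derivative_imp_has_field_derivative) (metis lin mult.commute)
  qed
  show "has_partials_at f z" "dx f z = D 1" "dy f z = D \<i>"
    using *[of 1] *[of \<i>] unfolding has_partials_at_def dx_def dy_def
    by (auto simp: DERIV_imp_deriv real_differentiable_def)
qed

lemma C1_on_has_derivative:
  assumes "C1_on U f" "open U" "z \<in> U"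
  shows "(f has_derivative (\<lambda>h. dx f z * Re h + dy f z * Im h)) (at z)"
proof -
  obtain e where e: "e > 0" "ball z e \<subseteq> U"
    using assms open_contains_ball by blast
  define X where "X = ball (Re z) (e/2)"
  define Y where "Y = ball (Im z) (e/2)"
  have in_U: "Complex x y \<in> U" if "x \<in> X" "y \<in> Y" for x y
  proof -
    have "cmod (z - Complex x y) \<le> \<bar>Re z - x\<bar> + \<bar>Im z - y\<bar>"
      using cmod_le[of "z - Complex x y"] by simp
    also have "\<dots> < e" using that by (simp add: X_def Y_def dist_real_def)
    finally show ?thesis using e by (auto simp: dist_norm)
  qed
  have open_XY: "open (X \<times> Y)" by (simp add: X_def Y_def open_Times)
  have z: "Re z \<in> X" "Im z \<in> Y" using e by (auto simp: X_def Y_def)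
  have "continuous_on (X \<times> Y) (\<lambda>p. dy f (Complex (fst p) (snd p)))"
  proof (rule continuous_on_compose2[of U "dy f"])
    show "continuous_on (X \<times> Y) (\<lambda>p. Complex (fst p) (snd p))"
      unfolding Complex_eq by (intro continuous_intros)
  qed (use assms in_U in \<open>auto simp: C1_on_def\<close>)
  then have cont: "continuous_on (X \<times> Y) (\<lambda>(x, y). blinfun_mult_right (dy f (Complex x y)))"
    unfolding split_def by (intro continuous_intros)
  have partials: "has_partials_at f w" if "w \<in> U" for w
    using assms that by (auto simp: C1_on_def)
  have "((\<lambda>(x, y). f (Complex x y)) has_derivative
     (\<lambda>(tx, ty). dx f z * tx + blinfun_mult_right (dy f (Complex (Re z) (Im z))) ty))
       (at (Re z, Im z) within X \<times> Y)"
  proof (rule has_derivative_partialsI)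
    have eq: "Complex 0 (Im z) + of_real t = Complex t (Im z)" for t by (simp add: complex_eq_iff)
    have "((\<lambda>t. f (Complex 0 (Im z) + of_real t)) has_real_derivative dx f (Complex 0 (Im z) + of_real (Re z))) (at (Re z))"
      by (intro has_real_derivative_dx partials) (simp add: eq assms)
    then show "((\<lambda>x. f (Complex x (Im z))) has_derivative (*) (dx f z)) (at (Re z) within X)"
      unfolding eq by (simp add: has_field_derivative_def has_derivative_at_withinI)
  next
    fix x y assume xy: "x \<in> X" "y \<in> Y"
    have eq: "Complex x 0 + \<i> * of_real t = Complex x t" for t by (simp add: complex_eq_iff)
    have "((\<lambda>t. f (Complex x 0 + \<i> * of_real t)) has_real_derivative dy f (Complex x 0 + \<i> * of_real y)) (at y)"
      by (intro has_real_derivative_dy partials) (simp add: eq in_U xy)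
    then show "((\<lambda>y. f (Complex x y)) has_derivative blinfun_apply (blinfun_mult_right (dy f (Complex x y)))) (at y within Y)"
      unfolding eq o_def by (simp add: has_field_derivative_def has_derivative_at_withinI)
  next
    show "continuous (at (Re z, Im z) within X \<times> Y) (\<lambda>(x, y). blinfun_mult_right (dy f (Complex x y)))"
      using cont z by (simp add: continuous_on_eq_continuous_within)
  qed (use z in \<open>auto simp: Y_def\<close>)
  then have "((\<lambda>(x, y). f (Complex x y)) has_derivative (\<lambda>(tx, ty). dx f z * tx + dy f z * ty)) (at (Re z, Im z))"
    using z open_XY by (subst (asm) at_within_open) auto
  then have "((\<lambda>(x, y). f (Complex x y)) \<circ> (\<lambda>w. (Re w, Im w)) has_derivative
      (\<lambda>(tx, ty). dx f z * tx + dy f z * ty) \<circ> (\<lambda>h. (Re h, Im h))) (at z)"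
    by (intro diff_chain_at) (auto intro!: derivative_eq_intros)
  then show ?thesis by (simp add: o_def)
qed

text \<open>Two applications of the mean value theorem, first in the direction \<open>v\<close> and then in the direction
\<open>u\<close>. The left-hand side is symmetric in the two directions, which is what identifies the mixed
partial derivatives below.\<close>

lemma second_difference_eq_mixed_derivative:
  fixes f g k :: "complex \<Rightarrow> real" and u v z :: complex
  assumes "h > 0"
    and f: "\<And>s t. s \<in> {0..h} \<Longrightarrow> t \<in> {0..h} \<Longrightarrow>
      ((\<lambda>s. f (z + v * of_real s + u * of_real t)) has_real_derivative g (z + v * of_real s + u * of_real t)) (at s)"
    and g: "\<And>s t. s \<in> {0..h} \<Longrightarrow> t \<in> {0..h} \<Longrightarrow>
      ((\<lambda>t. g (z + v * of_real s + u * of_real t)) has_real_derivative k (z + v * of_real s + u * of_real t)) (at t)"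
  obtains s t where "s \<in> {0..h}" "t \<in> {0..h}"
    "f (z + v * of_real h + u * of_real h) - f (z + v * of_real h) - f (z + u * of_real h) + f z
       = h\<^sup>2 * k (z + v * of_real s + u * of_real t)"
proof -
  define d where "d s = f (z + v * of_real s + u * of_real h) - f (z + v * of_real s + u * of_real 0)" for s
  have "\<exists>s. 0 < s \<and> s < h \<and>
      d h - d 0 = (h - 0) * (g (z + v * of_real s + u * of_real h) - g (z + v * of_real s + u * of_real 0))"
    unfolding d_def by (rule MVT2[OF \<open>h > 0\<close>]) (use \<open>h > 0\<close> in \<open>intro DERIV_diff f; simp\<close>)
  then obtain s where s: "0 < s" "s < h"
      "d h - d 0 = (h - 0) * (g (z + v * of_real s + u * of_real h) - g (z + v * of_real s + u * of_real 0))"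
    by blast
  obtain t where t: "0 < t" "t < h"
      "g (z + v * of_real s + u * of_real h) - g (z + v * of_real s + u * of_real 0)
        = (h - 0) * k (z + v * of_real s + u * of_real t)"
    using MVT2[OF \<open>h > 0\<close> g[of s]] s by auto
  have "d h - d 0 = h\<^sup>2 * k (z + v * of_real s + u * of_real t)"
    using s(3) t(3) by (simp add: power2_eq_square)
  then show ?thesis
    using s t by (intro that[of s t]) (auto simp: d_def)
qed

lemma C2_on_mixed_partials:
  assumes "C2_on U f" "open U" "z \<in> U"
  shows "dx (dy f) z = dy (dx f) z"
proof -
  have parts: "has_partials_at f w" "has_partials_at (dx f) w" "has_partials_at (dy f) w" if "w \<in> U" for w
    using assms that by (auto simp: C2_on_def C1_on_def)
  have cont: "isCont (dx (dy f)) z" "isCont (dy (dx f)) z"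
    using assms by (auto simp: C2_on_def C1_on_def continuous_on_eq_continuous_at)
  have "\<bar>dx (dy f) z - dy (dx f) z\<bar> < 2 * e" if "e > 0" for e
  proof -
    obtain r1 where r1: "r1 > 0" "\<And>w. dist w z < r1 \<Longrightarrow> dist (dx (dy f) w) (dx (dy f) z) < e"
      using cont(1) \<open>e > 0\<close> unfolding continuous_at_eps_delta by blast
    obtain r2 where r2: "r2 > 0" "\<And>w. dist w z < r2 \<Longrightarrow> dist (dy (dx f) w) (dy (dx f) z) < e"
      using cont(2) \<open>e > 0\<close> unfolding continuous_at_eps_delta by blast
    define r where "r = min r1 r2"
    have r: "r > 0"
      "\<And>w. dist w z < r \<Longrightarrow> dist (dx (dy f) w) (dx (dy f) z) < e"
      "\<And>w. dist w z < r \<Longrightarrow> dist (dy (dx f) w) (dy (dx f) z) < e"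
      using r1 r2 by (auto simp: r_def)
    obtain r' where r': "r' > 0" "ball z r' \<subseteq> U"
      using assms open_contains_ball by blast
    define h where "h = min r r' / 3"
    have h: "h > 0" using r r' by (simp add: h_def)
    have near: "dist (z + of_real s + \<i> * of_real t) z < min r r'" if "s \<in> {0..h}" "t \<in> {0..h}" for s t
    proof -
      have "dist (z + of_real s + \<i> * of_real t) z = cmod (of_real s + \<i> * of_real t)"
        by (simp add: dist_norm algebra_simps)
      also have "\<dots> \<le> \<bar>s\<bar> + \<bar>t\<bar>"
        by (rule order_trans[OF norm_triangle_ineq]) (simp add: norm_mult)
      also have "\<dots> < min r r'" using that h by (simp add: h_def)
      finally show ?thesis .
    qed
    then have in_U: "z + of_real s + \<i> * of_real t \<in> U" if "s \<in> {0..h}" "t \<in> {0..h}" for s t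
      using that r' by (force simp: dist_commute)
    have in_U': "z + \<i> * of_real t + of_real s \<in> U" if "s \<in> {0..h}" "t \<in> {0..h}" for s t
      using in_U[OF that] by (simp add: add_ac)
    obtain s t where st: "s \<in> {0..h}" "t \<in> {0..h}"
      "f (z + 1 * of_real h + \<i> * of_real h) - f (z + 1 * of_real h) - f (z + \<i> * of_real h) + f z
        = h\<^sup>2 * dy (dx f) (z + 1 * of_real s + \<i> * of_real t)"
    proof (rule second_difference_eq_mixed_derivative[OF h, of f z 1 \<i> "dx f" "dy (dx f)"])
      fix s t assume st: "s \<in> {0..h}" "t \<in> {0..h}"
      show "((\<lambda>t. dx f (z + 1 * of_real s + \<i> * of_real t)) has_real_derivative
             dy (dx f) (z + 1 * of_real s + \<i> * of_real t)) (at t)"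
        using st by (intro has_real_derivative_dy parts) (simp add: in_U)
      have "((\<lambda>s. f (z + \<i> * of_real t + of_real s)) has_real_derivative
             dx f (z + \<i> * of_real t + of_real s)) (at s)"
        using st by (intro has_real_derivative_dx parts) (simp add: in_U')
      then show "((\<lambda>s. f (z + 1 * of_real s + \<i> * of_real t)) has_real_derivative
             dx f (z + 1 * of_real s + \<i> * of_real t)) (at s)"
        by (simp add: add_ac)
    qed
    obtain t' s' where st': "t' \<in> {0..h}" "s' \<in> {0..h}"
      "f (z + \<i> * of_real h + 1 * of_real h) - f (z + \<i> * of_real h) - f (z + 1 * of_real h) + f z
        = h\<^sup>2 * dx (dy f) (z + \<i> * of_real t' + 1 * of_real s')"
    proof (rule second_difference_eq_mixed_derivative[OF h, of f z \<i> 1 "dy f" "dx (dy f)"])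
      fix t s assume st: "t \<in> {0..h}" "s \<in> {0..h}"
      have "((\<lambda>s. dy f (z + \<i> * of_real t + of_real s)) has_real_derivative
             dx (dy f) (z + \<i> * of_real t + of_real s)) (at s)"
        using st by (intro has_real_derivative_dx parts) (simp add: in_U')
      then show "((\<lambda>s. dy f (z + \<i> * of_real t + 1 * of_real s)) has_real_derivative
             dx (dy f) (z + \<i> * of_real t + 1 * of_real s)) (at s)" by simp
      have "((\<lambda>t. f (z + of_real s + \<i> * of_real t)) has_real_derivative
             dy f (z + of_real s + \<i> * of_real t)) (at t)"
        using st by (intro has_real_derivative_dy parts) (simp add: in_U)
      then show "((\<lambda>t. f (z + \<i> * of_real t + 1 * of_real s)) has_real_derivative
             dy f (z + \<i> * of_real t + 1 * of_real s)) (at t)"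
        by (simp add: add_ac)
    qed
    have "h\<^sup>2 * dy (dx f) (z + 1 * of_real s + \<i> * of_real t)
        = h\<^sup>2 * dx (dy f) (z + \<i> * of_real t' + 1 * of_real s')"
      unfolding st(3)[symmetric] st'(3)[symmetric] by (simp add: add_ac)
    then have "dy (dx f) (z + of_real s + \<i> * of_real t) = dx (dy f) (z + of_real s' + \<i> * of_real t')"
      using h by (simp add: add_ac)
    moreover have "dist (dy (dx f) (z + of_real s + \<i> * of_real t)) (dy (dx f) z) < e"
      using r near[OF st(1,2)] by simp
    moreover have "dist (dx (dy f) (z + of_real s' + \<i> * of_real t')) (dx (dy f) z) < e"
      using r near[OF st'(2,1)] by simp
    ultimately show ?thesis by (simp add: dist_real_def)
  qed
  from this[of "\<bar>dx (dy f) z - dy (dx f) z\<bar> / 2"] show ?thesis by (cases "dx (dy f) z = dy (dx f) z") auto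
qed

section \<open>The Poincare lemma for continuously differentiable one-forms on a disk\<close>

lemma has_wirtinger_compose:
  assumes "has_wirtinger f a b (g x)" "(g has_derivative g') (at x)"
  shows "((\<lambda>x. f (g x)) has_derivative (\<lambda>h. a * g' h + b * cnj (g' h))) (at x)"
  using has_derivative_compose[OF assms(2) assms(1)[unfolded has_wirtinger_def]] .

text \<open>The integrand is the derivative of \<open>t f(t z)\<close> with respect to \<open>t\<close>.\<close>

lemma integral_radial_derivative:
  assumes "\<And>t. t \<in> {0..1} \<Longrightarrow> has_wirtinger f (a (of_real t * z)) (b (of_real t * z)) (of_real t * z)"
  shows "((\<lambda>t::real. f (of_real t * z) + of_real t * (a (of_real t * z) * z + b (of_real t * z) * cnj z))
           has_integral f z) {0..1}"
proof -
  let ?A = "\<lambda>t::real. f (of_real t * z) + of_real t * (a (of_real t * z) * z + b (of_real t * z) * cnj z)"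
  have "(?A has_integral (of_real 1 * f (of_real 1 * z) - of_real 0 * f (of_real 0 * z))) {0..1}"
  proof (rule fundamental_theorem_of_calculus[where f="\<lambda>t. of_real t * f (of_real t * z)"])
    fix t :: real assume t: "t \<in> {0..1}"
    have "((\<lambda>t. f (of_real t * z)) has_derivative
        (\<lambda>h. a (of_real t * z) * (of_real h * z) + b (of_real t * z) * cnj (of_real h * z))) (at t)"
      by (rule has_wirtinger_compose[where f=f and g="\<lambda>t. of_real t * z" and x=t, OF assms[OF t]]) (auto intro!: derivative_eq_intros)
    then have "((\<lambda>t. of_real t * f (of_real t * z)) has_derivative (\<lambda>h. h *\<^sub>R ?A t)) (at t)"
      by (rule has_derivative_eq_rhs[OF has_derivative_mult[OF has_derivative_of_real[OF has_derivative_ident]]])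
         (simp add: fun_eq_iff scaleR_conv_of_real algebra_simps)
    then show "((\<lambda>t. of_real t * f (of_real t * z)) has_vector_derivative ?A t) (at t within {0..1})"
      by (simp add: has_vector_derivative_def has_derivative_at_withinI)
  qed simp
  then show ?thesis by simp
qed

lemma continuous_on_slice:
  assumes "continuous_on (S \<times> T) (\<lambda>p. Q (fst p) (snd p))" "z \<in> S"
  shows "continuous_on T (Q z)"
proof -
  have "continuous_on T (\<lambda>t. Q (fst (z, t)) (snd (z, t)))"
    by (rule continuous_on_compose2[OF assms(1)]) (use assms(2) in \<open>auto intro!: continuous_on_Pair\<close>)
  then show ?thesis by simp
qed

text \<open>The form \<open>f dz + g dzb\<close> is closed when the \<open>zb\<close>-derivative of \<open>f\<close> and the \<open>z\<close>-derivative of \<open>g\<close> agree;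
both are called \<open>k\<close> here. The primitive is the radial integral of the form. Differentiating under the
integral sign in the direction \<open>h\<close> produces, thanks to closedness, \<open>h\<close> times the radial derivative of
\<open>f\<close> plus \<open>cnj h\<close> times that of \<open>g\<close>, and these integrate to \<open>f z\<close> and \<open>g z\<close> by the previous lemma.\<close>

lemma closed_form_exact:
  fixes f g fz fb gz gb :: "complex \<Rightarrow> complex"
  assumes f: "\<And>z. z \<in> ball 0 r \<Longrightarrow> has_wirtinger f (fz z) (k z) z"
    and g: "\<And>z. z \<in> ball 0 r \<Longrightarrow> has_wirtinger g (k z) (gb z) z"
    and cont: "continuous_on (ball 0 r) fz" "continuous_on (ball 0 r) k" "continuous_on (ball 0 r) gb"
  shows "\<exists>M. \<forall>z\<in>ball 0 r. has_wirtinger M (f z) (g z) z"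
proof -
  define M where "M z = integral {0..1} (\<lambda>t::real. f (of_real t * z) * z + g (of_real t * z) * cnj z)" for z
  define A where "A z t = f (of_real t * z) + of_real t * (fz (of_real t * z) * z + k (of_real t * z) * cnj z)" for z and t :: real
  define B where "B z t = g (of_real t * z) + of_real t * (k (of_real t * z) * z + gb (of_real t * z) * cnj z)" for z and t :: real
  define cnjL where "cnjL = Blinfun cnj"
  have cnjL: "blinfun_apply cnjL = cnj"
    unfolding cnjL_def by (rule bounded_linear_Blinfun_apply) (rule bounded_linear_cnj)
  define D where "D z t = blinfun_mult_right (A z t) + (blinfun_mult_right (B z t) o\<^sub>L cnjL)" for z t
  have D: "blinfun_apply (D z t) h = A z t * h + B z t * cnj h" for z t h
    by (simp add: D_def cnjL plus_blinfun.rep_eq)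
  have seg: "of_real t * z \<in> ball 0 r" if "z \<in> ball 0 r" "t \<in> {0..1}" for z :: complex and t :: real
    using that by (simp add: norm_mult) (metis mult_left_le_one_le norm_ge_zero order.strict_trans1)
  have contf: "continuous_on (ball 0 r) f" "continuous_on (ball 0 r) g"
    using f g by (blast intro: has_wirtinger_imp_continuous)+
  have cscale: "continuous_on (ball 0 r \<times> {0..1}) (\<lambda>p. q (of_real (snd p) * fst p))"
    if "continuous_on (ball 0 r) q" for q :: "complex \<Rightarrow> complex"
    by (rule continuous_on_compose2[OF that]) (use seg in \<open>force intro!: continuous_intros\<close>)+
  note cs = contf[THEN cscale] cont[THEN cscale]
  have cA: "continuous_on (ball 0 r \<times> {0..1}) (\<lambda>p. A (fst p) (snd p))"
    unfolding A_def by (intro continuous_intros cs)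
  have cB: "continuous_on (ball 0 r \<times> {0..1}) (\<lambda>p. B (fst p) (snd p))"
    unfolding B_def by (intro continuous_intros cs)
  have cD: "continuous_on (ball 0 r \<times> {0..1}) (\<lambda>p. D (fst p) (snd p))"
    unfolding D_def by (intro continuous_intros cA cB)
  have intA: "integral {0..1} (A z) = f z" and intB: "integral {0..1} (B z) = g z"
    if z: "z \<in> ball 0 r" for z
    unfolding A_def B_def
    by (intro integral_unique integral_radial_derivative f g seg z; simp)+
  have "has_wirtinger M (f z) (g z) z" if z: "z \<in> ball 0 r" for z
  proof -
    have "((\<lambda>z. integral (cbox 0 1) (\<lambda>t::real. f (of_real t * z) * z + g (of_real t * z) * cnj z))
        has_derivative blinfun_apply (integral (cbox 0 1) (D z))) (at z within ball 0 r)"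
    proof (rule leibniz_rule)
      fix z :: complex and t :: real assume zt: "z \<in> ball 0 r" "t \<in> cbox 0 1"
      have f1: "((\<lambda>z. f (of_real t * z)) has_derivative
          (\<lambda>h. fz (of_real t * z) * (of_real t * h) + k (of_real t * z) * cnj (of_real t * h))) (at z)"
        by (rule has_wirtinger_compose[OF f]) (use seg zt in \<open>auto intro!: derivative_eq_intros\<close>)
      have g1: "((\<lambda>z. g (of_real t * z)) has_derivative
          (\<lambda>h. k (of_real t * z) * (of_real t * h) + gb (of_real t * z) * cnj (of_real t * h))) (at z)"
        by (rule has_wirtinger_compose[OF g]) (use seg zt in \<open>auto intro!: derivative_eq_intros\<close>)
      have "((\<lambda>z. f (of_real t * z) * z + g (of_real t * z) * cnj z) has_derivative blinfun_apply (D z t)) (at z)"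
        by (rule has_derivative_eq_rhs[OF has_derivative_add[OF has_derivative_mult[OF f1 has_derivative_ident]
              has_derivative_mult[OF g1 has_derivative_cnj[OF has_derivative_ident]]]])
           (simp add: D A_def B_def fun_eq_iff algebra_simps)
      then show "((\<lambda>z. f (of_real t * z) * z + g (of_real t * z) * cnj z) has_derivative blinfun_apply (D z t)) (at z within ball 0 r)"
        by (rule has_derivative_at_withinI)
    next
      fix z :: complex assume z: "z \<in> ball 0 r"
      have "continuous_on {0..1} (\<lambda>t. f (of_real t * z))" "continuous_on {0..1} (\<lambda>t. g (of_real t * z))"
        using continuous_on_slice[where Q="\<lambda>z t. f (of_real t * z)", OF cscale[OF contf(1)] z]
          continuous_on_slice[where Q="\<lambda>z t. g (of_real t * z)", OF cscale[OF contf(2)] z] .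
      then show "(\<lambda>t. f (complex_of_real t * z) * z + g (complex_of_real t * z) * cnj z) integrable_on cbox 0 1"
        unfolding cbox_interval by (intro integrable_continuous_interval continuous_intros)
    qed (use cD z in \<open>auto simp: split_def\<close>)
    moreover have "blinfun_apply (integral (cbox 0 1) (D z)) h = f z * h + g z * cnj h" for h
    proof -
      have "D z integrable_on cbox 0 1"
        using continuous_on_slice[where Q=D, OF cD z]
        by (simp only: cbox_interval integrable_continuous_interval)
      then have "blinfun_apply (integral (cbox 0 1) (D z)) h = integral {0..1} (\<lambda>t. A z t * h + B z t * cnj h)"
        by (simp only: blinfun_apply_integral D cbox_interval)
      also have "\<dots> = integral {0..1} (A z) * h + integral {0..1} (B z) * cnj h"
        using continuous_on_slice[where Q=A, OF cA z] continuous_on_slice[where Q=B, OF cB z]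

        by (simp add: integral_add integrable_continuous_interval continuous_on_mult_right)
      finally show ?thesis using z by (simp add: intA intB)
    qed
    then have "blinfun_apply (integral (cbox 0 1) (D z)) = (\<lambda>h. f z * h + g z * cnj h)" by (rule ext)
    ultimately have "(M has_derivative (\<lambda>h. f z * h + g z * cnj h)) (at z within ball 0 r)"
      unfolding M_def cbox_interval by (simp only:)
    then show ?thesis
      using z by (simp add: has_wirtinger_def at_within_open[OF z])
  qed
  then show ?thesis by blast
qed

section \<open>The equation and its solutions in terms of a holomorphic potential\<close>

text \<open>Up to the factor 2, this is the conformal factor of the metric of curvature \<open>\<kappa>\<close>. Working with the
inverse of \<open>1 + \<kappa> |z|\<^sup>2\<close> as a quantity of its own keeps every Wirtinger derivative polynomial, so that
the identities below are consequences of \<open>\<kappa>\<^sup>2 = 1\<close> and of the defining relation of this factor.\<close>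

definition conf_factor :: "real \<Rightarrow> complex \<Rightarrow> complex" where
  "conf_factor \<kappa> z = inverse (1 + of_real \<kappa> * (z * cnj z))"

lemma conf_factor_eq_of_real: "conf_factor \<kappa> z = of_real (1 / (1 + \<kappa> * (cmod z)\<^sup>2))"
  by (simp add: conf_factor_def complex_norm_square[symmetric] inverse_eq_divide del: of_real_power)

lemma cnj_conf_factor: "cnj (conf_factor \<kappa> z) = conf_factor \<kappa> z"
  by (simp add: conf_factor_eq_of_real)

lemma conf_factor_inverse:
  assumes "1 + \<kappa> * (cmod z)\<^sup>2 \<noteq> 0"
  shows "conf_factor \<kappa> z * (1 + of_real \<kappa> * (z * cnj z)) = 1"
proof -
  have "1 + of_real \<kappa> * (z * cnj z) = of_real (1 + \<kappa> * (cmod z)\<^sup>2)"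
    by (simp add: complex_norm_square[symmetric] del: of_real_power)
  then show ?thesis using assms unfolding conf_factor_def by (metis left_inverse of_real_eq_0_iff)
qed

lemma has_wirtinger_conf_factor:
  assumes "1 + \<kappa> * (cmod z)\<^sup>2 \<noteq> 0"
  shows "has_wirtinger (conf_factor \<kappa>) (- of_real \<kappa> * cnj z * (conf_factor \<kappa> z)\<^sup>2) (- of_real \<kappa> * z * (conf_factor \<kappa> z)\<^sup>2) z"
proof -
  have nz: "1 + of_real \<kappa> * (z * cnj z) \<noteq> 0"
    using conf_factor_inverse[OF assms] by auto
  have "has_wirtinger (\<lambda>z. 1 / (1 + of_real \<kappa> * (z * cnj z)))
      (- of_real \<kappa> * cnj z * (conf_factor \<kappa> z)\<^sup>2) (- of_real \<kappa> * z * (conf_factor \<kappa> z)\<^sup>2) z"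
    by (rule has_wirtinger_eq, (rule has_wirtinger_intros nz)+)
       (simp_all add: conf_factor_def field_simps)
  then show ?thesis by (simp add: conf_factor_def [abs_def] inverse_eq_divide)
qed

text \<open>The \<open>zb\<close>-derivative of \<open>p\<close> is a quarter of the Laplacian plus a multiple of the difference of the mixed
partial derivatives, which vanishes by \<open>C2_on_mixed_partials\<close>.\<close>

lemma C2_on_has_wirtinger:
  assumes "C2_on U \<phi>" "open U"
  obtains p pz where
    "\<And>z. z \<in> U \<Longrightarrow> has_wirtinger (\<lambda>z. of_real (\<phi> z)) (p z) (cnj (p z)) z"
    "\<And>z. z \<in> U \<Longrightarrow> has_wirtinger p (pz z) (of_real (laplacian \<phi> z / 4)) z"
    "continuous_on U pz"
proof -
  define p where "p z = (of_real (dx \<phi> z) - \<i> * of_real (dy \<phi> z)) / 2" for z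
  define pz where "pz z = (Complex (dx (dx \<phi>) z / 2) (- dy (dx \<phi>) z / 2)
     - \<i> * Complex (dx (dy \<phi>) z / 2) (- dy (dy \<phi>) z / 2)) / 2" for z
  have C1: "C1_on U \<phi>" "C1_on U (dx \<phi>)" "C1_on U (dy \<phi>)"
    using assms by (auto simp: C2_on_def)
  note W = C1[THEN C1_on_has_derivative, OF \<open>open U\<close>, THEN has_wirtinger_of_real]
  show thesis
  proof (rule that[of p pz])
    fix z assume z: "z \<in> U"
    show "has_wirtinger (\<lambda>z. of_real (\<phi> z)) (p z) (cnj (p z)) z"
      by (rule has_wirtinger_eq[OF W(1)[OF z]]) (simp_all add: p_def complex_eq_iff)
    have "has_wirtinger (\<lambda>z. (of_real (dx \<phi> z) - \<i> * of_real (dy \<phi> z)) / 2)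
       (pz z) (of_real (laplacian \<phi> z / 4)) z"
      by (rule has_wirtinger_eq, (rule has_wirtinger_divide has_wirtinger_diff has_wirtinger_mult has_wirtinger_const W(2)[OF z] W(3)[OF z])+)
         (simp_all add: pz_def laplacian_def complex_eq_iff C2_on_mixed_partials[OF assms z] field_simps)
    then show "has_wirtinger p (pz z) (of_real (laplacian \<phi> z / 4)) z"
      by (simp add: p_def [abs_def])
  next
    show "continuous_on U pz"
      unfolding pz_def Complex_eq using C1 by (intro continuous_intros) (auto simp: C1_on_def)
  qed
qed

lemma has_wirtinger_C2_on:
  assumes "open U"
    and \<phi>: "\<And>z. z \<in> U \<Longrightarrow> has_wirtinger (\<lambda>z. of_real (\<phi> z)) (p z) (cnj (p z)) z"
    and p: "\<And>z. z \<in> U \<Longrightarrow> has_wirtinger p (pz z) (of_real (L z)) z"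
    and cont: "continuous_on U pz" "continuous_on U L"
  shows "C2_on U \<phi>" "\<And>z. z \<in> U \<Longrightarrow> laplacian \<phi> z = 4 * L z"
proof -
  have 1: "has_partials_at \<phi> z" "dx \<phi> z = 2 * Re (p z)" "dy \<phi> z = - 2 * Im (p z)" if "z \<in> U" for z
  proof -
    have "((\<lambda>z. Re (of_real (\<phi> z))) has_derivative (\<lambda>h. Re (p z * h + cnj (p z) * cnj h))) (at z)"
      using \<phi>[OF that] unfolding has_wirtinger_def by (rule has_derivative_Re)
    from partials_of_derivative[OF this] show "has_partials_at \<phi> z" "dx \<phi> z = 2 * Re (p z)" "dy \<phi> z = - 2 * Im (p z)"
      by simp_all
  qed
  have dR: "((\<lambda>z. 2 * Re (p z)) has_derivative (\<lambda>h. 2 * Re (pz z * h + of_real (L z) * cnj h))) (at z)"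
    and dI: "((\<lambda>z. - 2 * Im (p z)) has_derivative (\<lambda>h. - 2 * Im (pz z * h + of_real (L z) * cnj h))) (at z)"
    if "z \<in> U" for z
    using p[OF that] unfolding has_wirtinger_def
    by (intro has_derivative_mult_right has_derivative_Re has_derivative_Im; simp)+
  have dxd: "(dx \<phi> has_derivative (\<lambda>h. 2 * Re (pz z * h + of_real (L z) * cnj h))) (at z)"
    and dyd: "(dy \<phi> has_derivative (\<lambda>h. - 2 * Im (pz z * h + of_real (L z) * cnj h))) (at z)"
    if "z \<in> U" for z
    using has_derivative_transform_within_open[OF dR[OF that] \<open>open U\<close> that]
      has_derivative_transform_within_open[OF dI[OF that] \<open>open U\<close> that] 1 by auto
  note 2 = partials_of_derivative[OF dxd] partials_of_derivative[OF dyd]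
  have cp: "continuous_on U p" using p by (rule has_wirtinger_imp_continuous)
  have "continuous_on U (dx \<phi>)" "continuous_on U (dy \<phi>)"
    using 1 cp by (auto intro!: continuous_intros cong: continuous_on_cong)
  moreover have "continuous_on U (dx (dx \<phi>))" "continuous_on U (dy (dx \<phi>))"
    "continuous_on U (dx (dy \<phi>))" "continuous_on U (dy (dy \<phi>))"
    using 2 cont by (auto intro!: continuous_intros cong: continuous_on_cong)
  ultimately show "C2_on U \<phi>"
    using 1 2 by (auto simp: C2_on_def C1_on_def)
  show "laplacian \<phi> z = 4 * L z" if "z \<in> U" for z
    using 2[OF that] by (simp add: laplacian_def)
qed

lemma has_wirtinger_Re:
  assumes "has_wirtinger f a b z"
  shows "has_wirtinger (\<lambda>z. of_real (Re (f z))) ((a + cnj b) / 2) (cnj ((a + cnj b) / 2)) z"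
proof -
  have "has_wirtinger (\<lambda>z. (f z + cnj (f z)) / 2) ((a + cnj b) / 2) (cnj ((a + cnj b) / 2)) z"
    by (rule has_wirtinger_eq, (rule has_wirtinger_divide has_wirtinger_add has_wirtinger_cnj has_wirtinger_const assms)+)
       (simp_all add: field_simps)
  then show ?thesis by (simp add: complex_add_cnj)
qed

text \<open>The derivative of \<open>H\<close> is a separate argument so that the primitive of \<open>F\<close> can be used with \<open>F\<close> itself
as its derivative.\<close>

definition potential_field :: "real \<Rightarrow> (complex \<Rightarrow> complex) \<Rightarrow> (complex \<Rightarrow> complex) \<Rightarrow> complex \<Rightarrow> complex" where
  "potential_field \<kappa> H H' z = H' z - 2 * of_real \<kappa> * cnj z * H z * conf_factor \<kappa> z"

text \<open>For \<open>u = potential_field \<kappa> H H'\<close> the \<open>zb\<close>-derivative is \<open>- 2 \<kappa> H / w\<^sup>2\<close>, where \<open>w = 1 + \<kappa> |z|\<^sup>2\<close>, and differentiating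
this with respect to \<open>z\<close> gives \<open>- 2 \<kappa> u / w\<^sup>2\<close>; the real part inherits this, the equation being real
and linear.
The coefficient \<open>p\<close> of the real part moreover satisfies \<open>p\<^sub>z = H'''/2 - 2 \<kappa> cnj z p / w\<close>, which
shows that \<open>p\<^sub>z\<close> is continuous.\<close>

lemma potential_field_solution:
  assumes "open U" and w: "\<And>z. z \<in> U \<Longrightarrow> 1 + \<kappa> * (cmod z)\<^sup>2 \<noteq> 0" and \<kappa>: "\<kappa> \<in> {1, -1}"
    and H: "\<And>z. z \<in> U \<Longrightarrow> (H has_field_derivative H1 z) (at z)"
    and \<phi>: "\<And>z. z \<in> U \<Longrightarrow> \<phi> z = Re (potential_field \<kappa> H H1 z)"
  shows "C2_on U \<phi>" "\<And>z. z \<in> U \<Longrightarrow> laplacian \<phi> z = - \<kappa> * (8 * \<phi> z / (1 + \<kappa> * (cmod z)\<^sup>2)\<^sup>2)"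
proof -
  let ?K = "complex_of_real \<kappa>" and ?v = "conf_factor \<kappa>"
  have K: "?K * ?K = 1" using \<kappa> by auto
  have "H holomorphic_on U"
    using H \<open>open U\<close> by (auto simp: holomorphic_on_open)
  have "H1 z = deriv H z" if "z \<in> U" for z
    using H[OF that] by (simp add: DERIV_imp_deriv)
  then have "H1 holomorphic_on U"
    using \<open>open U\<close> \<open>H holomorphic_on U\<close> by (metis holomorphic_deriv holomorphic_transform)
  define H2 H3 where "H2 = deriv H1" and "H3 = deriv H2"
  have "H2 holomorphic_on U" "H3 holomorphic_on U"
    using \<open>open U\<close> \<open>H1 holomorphic_on U\<close> by (auto simp: H2_def H3_def intro!: holomorphic_deriv)
  have H1: "(H1 has_field_derivative H2 z) (at z)" and H2: "(H2 has_field_derivative H3 z) (at z)" if "z \<in> U" for z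
    using that \<open>open U\<close> \<open>H1 holomorphic_on U\<close> \<open>H2 holomorphic_on U\<close>
    by (auto simp: H2_def H3_def intro: holomorphic_derivI)
  define p where "p z = (H2 z - 2 * ?K * cnj z * H1 z * ?v z + 2 * (cnj z)\<^sup>2 * H z * (?v z)\<^sup>2
      + cnj (- 2 * ?K * H z * (?v z)\<^sup>2)) / 2" for z
  define L where "L z = - 2 * \<kappa> * \<phi> z / (1 + \<kappa> * (cmod z)\<^sup>2)\<^sup>2" for z
  note intros = has_wirtinger_intros has_wirtinger_conf_factor[OF w] H[THEN has_wirtinger_holomorphic]
    H1[THEN has_wirtinger_holomorphic] H2[THEN has_wirtinger_holomorphic]
  have d\<phi>: "has_wirtinger (\<lambda>z. of_real (\<phi> z)) (p z) (cnj (p z)) z" if z: "z \<in> U" for z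
  proof (rule has_wirtinger_transform[OF _ \<open>open U\<close> z])
    have v: "?v z + ?v z * ?K * z * cnj z = 1" using conf_factor_inverse[OF w[OF z]] by (simp add: algebra_simps)
    have "has_wirtinger (potential_field \<kappa> H H1)
       (H2 z - 2 * ?K * cnj z * H1 z * ?v z + 2 * (cnj z)\<^sup>2 * H z * (?v z)\<^sup>2)
       (- 2 * ?K * H z * (?v z)\<^sup>2) z"
      unfolding potential_field_def [abs_def]
    proof (rule has_wirtinger_eq, (rule intros z)+)
    qed (use K v in \<open>simp_all, algebra+\<close>)
    from has_wirtinger_Re[OF this]
    show "has_wirtinger (\<lambda>z. of_real (Re (potential_field \<kappa> H H1 z))) (p z) (cnj (p z)) z"
      unfolding p_def .
  qed (simp add: \<phi>)
  have dp: "has_wirtinger p (H3 z / 2 - 2 * ?K * cnj z * p z * ?v z) (of_real (L z)) z" if z: "z \<in> U" for z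
  proof -
    have v: "?v z + ?v z * ?K * z * cnj z = 1" using conf_factor_inverse[OF w[OF z]] by (simp add: algebra_simps)
    have Lz: "of_real (L z) = - ?K * (potential_field \<kappa> H H1 z + cnj (potential_field \<kappa> H H1 z)) * (?v z)\<^sup>2"
      unfolding complex_add_cnj by (simp add: L_def \<phi>[OF z] conf_factor_eq_of_real field_simps)
    have two: "(2::complex) \<noteq> 0" by simp
    show ?thesis
      unfolding Lz p_def [abs_def]
    proof (rule has_wirtinger_eq, (rule intros z two)+, goal_cases)
      case 1
      show ?case using K v by (simp add: field_simps cnj_conf_factor) algebra
    next
      case 2
      show ?case using K v by (simp add: potential_field_def cnj_conf_factor field_simps) algebra
    qed
  qed
  have cw: "continuous_on U ?v" using has_wirtinger_conf_factor[OF w] by (rule has_wirtinger_imp_continuous)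
  have cp: "continuous_on U p" using dp by (rule has_wirtinger_imp_continuous)
  have c\<phi>: "continuous_on U \<phi>"
  proof -
    have "continuous_on U (\<lambda>z. complex_of_real (\<phi> z))" using d\<phi> by (rule has_wirtinger_imp_continuous)
    then have "continuous_on U (\<lambda>z. Re (complex_of_real (\<phi> z)))" by (rule continuous_on_Re)
    then show ?thesis by simp
  qed
  have "continuous_on U (\<lambda>z. H3 z / 2 - 2 * ?K * cnj z * p z * ?v z)"
    using \<open>H3 holomorphic_on U\<close>
    by (intro continuous_intros cw cp holomorphic_on_imp_continuous_on) auto
  moreover have "continuous_on U L"
    unfolding L_def using w by (intro continuous_intros c\<phi>) auto
  ultimately show "C2_on U \<phi>" "\<And>z. z \<in> U \<Longrightarrow> laplacian \<phi> z = - \<kappa> * (8 * \<phi> z / (1 + \<kappa> * (cmod z)\<^sup>2)\<^sup>2)"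
    using has_wirtinger_C2_on[OF \<open>open U\<close> d\<phi> dp] by (auto simp: L_def)
qed

section \<open>Every solution has a potential\<close>

text \<open>The coefficients \<open>p\<close> and \<open>pz\<close> stand for the first and second \<open>z\<close>-derivative of \<open>\<phi>\<close>, and the value of
the \<open>zb\<close>-derivative of \<open>p\<close> is the equation. The closed form below is built from \<open>\<phi>\<close> and \<open>p\<close> only, so that
continuity of \<open>pz\<close> is all the regularity that is used.\<close>

lemma solution_potential:
  fixes \<phi> :: "complex \<Rightarrow> real"
  assumes w: "\<And>z. z \<in> ball 0 r \<Longrightarrow> 1 + \<kappa> * (cmod z)\<^sup>2 \<noteq> 0" and \<kappa>: "\<kappa> \<in> {1, -1}"
    and \<phi>: "\<And>z. z \<in> ball 0 r \<Longrightarrow> has_wirtinger (\<lambda>z. of_real (\<phi> z)) (p z) (cnj (p z)) z"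
    and p: "\<And>z. z \<in> ball 0 r \<Longrightarrow>
      has_wirtinger p (pz z) (- 2 * of_real \<kappa> * of_real (\<phi> z) * (conf_factor \<kappa> z)\<^sup>2) z"
    and cont: "continuous_on (ball 0 r) pz"
  obtains H H1 where "\<And>z. z \<in> ball 0 r \<Longrightarrow> (H has_field_derivative H1 z) (at z)"
    "\<And>z. z \<in> ball 0 r \<Longrightarrow> \<phi> z = Re (potential_field \<kappa> H H1 z)"
proof -
  let ?K = "complex_of_real \<kappa>" and ?v = "conf_factor \<kappa>" and ?D = "ball (0::complex) r"
  let ?\<phi> = "\<lambda>z. complex_of_real (\<phi> z)"
  have K: "?K * ?K = 1" using \<kappa> by auto
  have v: "?v z + ?v z * ?K * z * cnj z = 1" if "z \<in> ?D" for z
    using conf_factor_inverse[OF w[OF that]] by (simp add: algebra_simps)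
  note intros = has_wirtinger_intros has_wirtinger_conf_factor[OF w] \<phi> p
  define f where "f z = 2 * ?K * cnj z * p z * ?v z" for z
  define g where "g z = 2 * ?K * ?\<phi> z * (?v z)\<^sup>2" for z
  define k where "k z = 2 * ?K * p z * (?v z)\<^sup>2 - 4 * cnj z * ?\<phi> z * (?v z)^3" for z
  have df: "has_wirtinger f (2 * ?K * cnj z * pz z * ?v z - 2 * (cnj z)\<^sup>2 * p z * (?v z)\<^sup>2) (k z) z"
    if z: "z \<in> ?D" for z
    unfolding f_def [abs_def] k_def
  proof (rule has_wirtinger_eq, (rule intros z)+, goal_cases)
    case 1
    show ?case using K v[OF z] unfolding complex_cnj_cnj by algebra
  next
    case 2
    show ?case using K v[OF z] unfolding complex_cnj_cnj by algebra
  qed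
  have dg: "has_wirtinger g (k z) (2 * ?K * cnj (p z) * (?v z)\<^sup>2 - 4 * z * ?\<phi> z * (?v z)^3) z"
    if z: "z \<in> ?D" for z
    unfolding g_def [abs_def] k_def
  proof (rule has_wirtinger_eq, (rule intros z)+, goal_cases)
    case 1
    show ?case using K v[OF z] unfolding complex_cnj_cnj by algebra
  next
    case 2
    show ?case using K v[OF z] unfolding complex_cnj_cnj by algebra
  qed
  have c: "continuous_on ?D p" "continuous_on ?D ?v" "continuous_on ?D (\<lambda>z. Re (?\<phi> z))"
    subgoal using p by (rule has_wirtinger_imp_continuous)
    subgoal using has_wirtinger_conf_factor[OF w] by (rule has_wirtinger_imp_continuous)
    subgoal by (rule continuous_on_Re) (use \<phi> in \<open>rule has_wirtinger_imp_continuous\<close>)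
    done
  have "\<exists>M. \<forall>z\<in>?D. has_wirtinger M (f z) (g z) z"
    by (rule closed_form_exact[OF df dg], unfold k_def [abs_def])
       (assumption | intro continuous_intros c[unfolded Re_complex_of_real] cont)+
  then obtain M where M: "\<And>z. z \<in> ?D \<Longrightarrow> has_wirtinger M (f z) (g z) z" by blast
  define N where "N z = p z + M z" for z
  have dN: "has_wirtinger N (pz z + f z) 0 z" if z: "z \<in> ?D" for z
    unfolding N_def [abs_def]
    by (rule has_wirtinger_eq, (rule has_wirtinger_add p M z)+) (simp_all add: g_def)
  then have "N holomorphic_on ?D" by (rule has_wirtinger_imp_holomorphic)
  then obtain N1 where N1: "\<And>z. z \<in> ?D \<Longrightarrow> (N1 has_field_derivative N z) (at z)"
    using holomorphic_convex_primitive'[of ?D N] by (metis at_within_open convex_ball open_ball)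
  then have "N1 holomorphic_on ?D" by (subst holomorphic_on_open) blast+
  then obtain N2 where N2: "\<And>z. z \<in> ?D \<Longrightarrow> (N2 has_field_derivative N1 z) (at z)"
    using holomorphic_convex_primitive'[of ?D N1] by (metis at_within_open convex_ball open_ball)
  define w2 where "w2 z = 1 + ?K * z * cnj z" for z
  have vw: "?v z * w2 z = 1" if "z \<in> ?D" for z
    using v[OF that] by (simp add: w2_def algebra_simps)
  \<comment> \<open>The subtracted term has \<open>z\<close>-derivative \<open>w2\<^sup>2 N'\<close>, which is also that of \<open>w2\<^sup>2 p\<close>.\<close>
  define X where "X z = (w2 z)\<^sup>2 * p z
      - ((w2 z)\<^sup>2 * N z - 2 * ?K * cnj z * w2 z * N1 z + 2 * (cnj z)\<^sup>2 * N2 z)" for z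
  define b where "b z = 2 * w2 z * ?K * z * p z - 2 * ?K * ?\<phi> z - 2 * w2 z * ?K * z * N z
      + 2 * ?K * w2 z * N1 z + 2 * z * cnj z * N1 z - 4 * cnj z * N2 z" for z
  have dX: "has_wirtinger X 0 (b z) z" if z: "z \<in> ?D" for z
  proof -
    note N = dN[OF z] N1[OF z, THEN has_wirtinger_holomorphic] N2[OF z, THEN has_wirtinger_holomorphic]
    have dw2: "has_wirtinger w2 (?K * cnj z) (?K * z) z"
      unfolding w2_def [abs_def] by (rule has_wirtinger_eq, (rule has_wirtinger_intros)+) simp_all
    show ?thesis
      unfolding X_def [abs_def]
    proof (rule has_wirtinger_eq, (rule has_wirtinger_intros dw2 N p z)+, goal_cases)
      case 1
      show ?case using K vw[OF z] unfolding f_def by algebra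
    next
      case 2
      show ?case using K vw[OF z] unfolding b_def by algebra
    qed
  qed
  define B where "B z = cnj (X z)" for z
  have B: "(B has_field_derivative cnj (b z)) (at z)" if "z \<in> ?D" for z
    using has_wirtinger_cnj[OF dX[OF that]]
    by (simp add: B_def [abs_def] has_wirtinger_def has_field_derivative_def)
  show thesis
  proof (rule that[of "\<lambda>z. N2 z - ?K / 2 * B z" "\<lambda>z. N1 z - ?K / 2 * cnj (b z)"])
    fix z assume z: "z \<in> ?D"
    show "((\<lambda>z. N2 z - ?K / 2 * B z) has_field_derivative N1 z - ?K / 2 * cnj (b z)) (at z)"
      using N2[OF z] B[OF z] by (intro DERIV_diff DERIV_cmult)
    \<comment> \<open>Solve the definition of \<open>b\<close> for \<open>\<phi>\<close>, and that of \<open>X\<close> for \<open>p\<close>. The conjugated term is the field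
      of the potential \<open>- \<kappa> B / 2\<close>, since \<open>\<kappa>\<^sup>2 = 1\<close>; under the real part the conjugation disappears.\<close>
    have "?\<phi> z = (N1 z - 2 * ?K * cnj z * N2 z * ?v z) + cnj (- ?K / 2 * cnj (b z) + cnj z * B z * ?v z)"
      using K vw[OF z] w2_def[of z] unfolding b_def X_def B_def by (simp add: cnj_conf_factor field_simps) algebra
    then have "Re (?\<phi> z) = Re (potential_field \<kappa> N2 N1 z + (- ?K / 2 * cnj (b z) + cnj z * B z * ?v z))"
      by (simp only: potential_field_def plus_complex.simps cnj.simps)
    also have "potential_field \<kappa> N2 N1 z + (- ?K / 2 * cnj (b z) + cnj z * B z * ?v z)
        = potential_field \<kappa> (\<lambda>z. N2 z - ?K / 2 * B z) (\<lambda>z. N1 z - ?K / 2 * cnj (b z)) z"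
      using K unfolding potential_field_def by (simp add: field_simps)
    finally show "\<phi> z = Re (potential_field \<kappa> (\<lambda>z. N2 z - ?K / 2 * B z) (\<lambda>z. N1 z - ?K / 2 * cnj (b z)) z)"
      by simp
  qed
qed

text \<open>The potentials \<open>a + \<kappa> cnj a z\<^sup>2\<close> have fields \<open>2 \<kappa> (cnj a z - cnj (cnj a z)) / (1 + \<kappa> |z|\<^sup>2)\<close>, which are purely
imaginary. Subtracting the one with \<open>a = H 0\<close> leaves the real part of the field unchanged.\<close>

lemma potential_vanishing_at_0:
  assumes w: "\<And>z. z \<in> U \<Longrightarrow> 1 + \<kappa> * (cmod z)\<^sup>2 \<noteq> 0" and \<kappa>: "\<kappa> \<in> {1, -1}"
    and H: "\<And>z. z \<in> U \<Longrightarrow> (H has_field_derivative H1 z) (at z)"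
  obtains G G1 where "G 0 = 0" "\<And>z. z \<in> U \<Longrightarrow> (G has_field_derivative G1 z) (at z)"
    "\<And>z. z \<in> U \<Longrightarrow> Re (potential_field \<kappa> G G1 z) = Re (potential_field \<kappa> H H1 z)"
proof -
  let ?K = "complex_of_real \<kappa>" and ?v = "conf_factor \<kappa>"
  have K: "?K * ?K = 1" using \<kappa> by auto
  define a where "a = H 0"
  let ?G = "\<lambda>z. H z - (a + ?K * cnj a * z\<^sup>2)" and ?G1 = "\<lambda>z. H1 z - 2 * ?K * cnj a * z"
  show thesis
  proof (rule that[of ?G ?G1])
    show "?G 0 = 0" by (simp add: a_def)
  next
    fix z assume z: "z \<in> U"
    show "(?G has_field_derivative ?G1 z) (at z)"
      by (rule derivative_eq_intros H[OF z] refl)+ simp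
    have "?v z + ?v z * ?K * z * cnj z = 1"
      using conf_factor_inverse[OF w[OF z]] by (simp add: algebra_simps)
    then have "potential_field \<kappa> ?G ?G1 z = potential_field \<kappa> H H1 z - 2 * ?K * ?v z * (cnj a * z - cnj (cnj a * z))"
      using K unfolding potential_field_def complex_cnj_mult complex_cnj_cnj by algebra
    also have "\<dots> = potential_field \<kappa> H H1 z - of_real (2 * \<kappa> / (1 + \<kappa> * (cmod z)\<^sup>2)) * (cnj a * z - cnj (cnj a * z))"
      by (simp add: conf_factor_eq_of_real)
    finally show "Re (potential_field \<kappa> ?G ?G1 z) = Re (potential_field \<kappa> H H1 z)"
      by (simp add: complex_diff_cnj)
  qed
qed


section \<open>The two representation formulas\<close>

lemma mean_integral_primitive:
  assumes "\<And>w. w \<in> U \<Longrightarrow> (H has_field_derivative F w) (at w)" "H 0 = 0" "closed_segment 0 z \<subseteq> U"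
  shows "z * mean_integral F z = H z"
proof -
  have "(F has_contour_integral H (pathfinish (linepath 0 z)) - H (pathstart (linepath 0 z))) (linepath 0 z)"
    by (rule contour_integral_primitive[of U]) (simp_all only: valid_path_linepath path_image_linepath assms has_field_derivative_at_within)
  then have "contour_integral (linepath 0 z) F = H z"
    using assms(2) by (simp add: contour_integral_unique)
  then show ?thesis using assms(2) by (simp add: mean_integral_def)
qed

lemma rep_formula_pos:
  assumes "\<And>w. w \<in> U \<Longrightarrow> (H has_field_derivative F w) (at w)" "H 0 = 0" "closed_segment 0 z \<subseteq> U"
  shows "rep_formula 1 F z = Re (potential_field 1 H F z)"
proof -
  have "of_real (2 * (cmod z)\<^sup>2 / (1 + (cmod z)\<^sup>2)) * mean_integral F z
      = 2 * cnj z * (z * mean_integral F z) * conf_factor 1 z"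
    by (simp add: conf_factor_eq_of_real complex_norm_square field_simps del: of_real_power)
  then show ?thesis
    by (simp add: rep_formula_def potential_field_def mean_integral_primitive[OF assms])
qed

lemma rep_formula_neg:
  assumes "1 - (cmod z)\<^sup>2 \<noteq> 0"
  shows "rep_formula (-1) F z = Re (potential_field (-1) (\<lambda>z. z * F z) (\<lambda>z. F z + z * deriv F z) z)"
proof -
  have "of_real ((1 + (cmod z)\<^sup>2) / (1 - (cmod z)\<^sup>2)) = 1 + 2 * (cnj z * z) * conf_factor (-1) z"
  proof -
    have "(1 + (cmod z)\<^sup>2) / (1 - (cmod z)\<^sup>2) = 1 + 2 * (cmod z)\<^sup>2 * (1 / (1 - (cmod z)\<^sup>2))"
      using assms by (simp add: field_simps)
    then show ?thesis
      by (simp add: conf_factor_eq_of_real complex_norm_square mult.commute del: of_real_power)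
  qed
  then have "of_real ((1 + (cmod z)\<^sup>2) / (1 - (cmod z)\<^sup>2)) * F z + z * deriv F z
      = potential_field (-1) (\<lambda>z. z * F z) (\<lambda>z. F z + z * deriv F z) z"
    by (simp add: potential_field_def algebra_simps)
  then show ?thesis by (simp add: rep_formula_def)
qed

text \<open>Passing to a disk gives a neighbourhood that is convex, hence carries primitives, and is star-shaped
about the origin, as the representation demands.\<close>

lemma disk_nbhd_ball:
  assumes "disk_nbhd \<kappa> \<rho> U" "0 < \<rho>"
  obtains r where "\<rho> < r" "ball 0 r \<subseteq> U" "disk_nbhd \<kappa> \<rho> (ball 0 r)"
proof -
  have U: "open U" "cball 0 \<rho> \<subseteq> U" using assms by (auto simp: disk_nbhd_def)
  obtain e where e: "e > 0" "(\<Union>x\<in>cball 0 \<rho>. ball x e) \<subseteq> U"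
    using compact_subset_open_imp_ball_epsilon_subset[OF compact_cball U] by blast
  have "ball 0 (\<rho> + e) \<subseteq> U"
  proof
    fix z :: complex assume z: "z \<in> ball 0 (\<rho> + e)"
    show "z \<in> U"
    proof (cases "cmod z \<le> \<rho>")
      case False
      then have nz: "0 < cmod z" using assms by linarith
      let ?y = "(\<rho> / cmod z) *\<^sub>R z"
      have y: "?y \<in> cball 0 \<rho>" using assms nz by simp
      have "dist ?y z = cmod ((\<rho> / cmod z - 1) *\<^sub>R z)"
        by (simp add: dist_norm scaleR_diff_left)
      also have "\<dots> = cmod z - \<rho>" using nz False by (simp add: field_simps abs_if)
      finally have "z \<in> ball ?y e" using z by simp
      then show ?thesis using y e by blast
    qed (use U in auto)
  qed
  then show thesis
    using assms e by (intro that[of "\<rho> + e"]) (auto simp: disk_nbhd_def)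
qed

lemma representation_solution:
  assumes "\<kappa> \<in> {1, -1}" "disk_nbhd \<kappa> \<rho> U" "\<forall>z\<in>U. closed_segment 0 z \<subseteq> U" "F holomorphic_on U"
    and \<phi>: "\<forall>z\<in>U. \<phi> z = rep_formula \<kappa> F z \<and> \<kappa> * \<phi> z < 0"
  shows "solution_over_disk \<kappa> \<rho> \<phi>"
proof -
  have U: "open U" "\<And>z. z \<in> U \<Longrightarrow> 1 + \<kappa> * (cmod z)\<^sup>2 \<noteq> 0"
    using assms by (auto simp: disk_nbhd_def)
  have F: "(F has_field_derivative deriv F z) (at z)" if "z \<in> U" for z
    using assms(4) U(1) that by (rule holomorphic_derivI)
  obtain H H1 where H: "\<And>z. z \<in> U \<Longrightarrow> (H has_field_derivative H1 z) (at z)"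
    "\<And>z. z \<in> U \<Longrightarrow> \<phi> z = Re (potential_field \<kappa> H H1 z)"
  proof (cases "\<kappa> = 1")
    case True
    have "\<exists>g. \<forall>x\<in>U. (g has_field_derivative F x) (at x)"
    proof (cases "U = {}")
      case False
      then have "starlike U" using assms(3) unfolding starlike_def by (metis ends_in_segment(1) ex_in_conv subsetD)
      then show ?thesis
        using holomorphic_starlike_primitive[of U F "{}"] assms(4) U(1) F
        by (auto simp: holomorphic_on_imp_continuous_on field_differentiable_def)
    qed simp
    then obtain g where g: "\<And>z. z \<in> U \<Longrightarrow> (g has_field_derivative F z) (at z)" by blast
    let ?H = "\<lambda>z. g z - g 0"
    have H: "(?H has_field_derivative F z) (at z)" if "z \<in> U" for z
      using DERIV_diff[OF g[OF that] DERIV_const[of "g 0"]] by simp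
    show thesis
      by (rule that[OF H]) (use \<phi> rep_formula_pos[of U ?H F, OF H] assms(3) True in auto)
  next
    case False
    then have \<kappa>: "\<kappa> = -1" using assms(1) by simp
    show thesis
    proof (rule that[of "\<lambda>z. z * F z" "\<lambda>z. F z + z * deriv F z"])
      fix z assume z: "z \<in> U"
      show "((\<lambda>z. z * F z) has_field_derivative F z + z * deriv F z) (at z)"
        using DERIV_mult[OF DERIV_ident F[OF z]] by (simp add: add.commute mult.commute)
      show "\<phi> z = Re (potential_field \<kappa> (\<lambda>z. z * F z) (\<lambda>z. F z + z * deriv F z) z)"
        using \<phi> z U(2)[OF z] rep_formula_neg[of z F] by (simp add: \<kappa>)
    qed
  qed
  note S = potential_field_solution[OF U assms(1) H]
  show ?thesis
    unfolding solution_over_disk_def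
    using assms(2) S \<phi> by (intro exI[of _ U]) (auto simp: cmod_power2)
qed

lemma solution_representation:
  assumes \<kappa>: "\<kappa> \<in> {1, -1}" and "0 < \<rho>" "solution_over_disk \<kappa> \<rho> \<phi>"
  shows "\<exists>F U. disk_nbhd \<kappa> \<rho> U \<and> (\<forall>z\<in>U. closed_segment 0 z \<subseteq> U) \<and> F holomorphic_on U \<and>
           (\<forall>z\<in>U. \<phi> z = rep_formula \<kappa> F z \<and> \<kappa> * \<phi> z < 0)"
proof -
  obtain V where V: "disk_nbhd \<kappa> \<rho> V" "C2_on V \<phi>"
    "\<And>z. z \<in> V \<Longrightarrow> laplacian \<phi> z + \<kappa> * (8 * \<phi> z / (1 + \<kappa> * ((Re z)\<^sup>2 + (Im z)\<^sup>2))\<^sup>2) = 0"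
    "\<And>z. z \<in> V \<Longrightarrow> \<kappa> * \<phi> z < 0"
    using assms(3) unfolding solution_over_disk_def by blast
  obtain r where r: "\<rho> < r" "ball 0 r \<subseteq> V" "disk_nbhd \<kappa> \<rho> (ball 0 r)"
    using disk_nbhd_ball[OF V(1) \<open>0 < \<rho>\<close>] by blast
  let ?U = "ball (0::complex) r"
  have w: "1 + \<kappa> * (cmod z)\<^sup>2 \<noteq> 0" if "z \<in> ?U" for z
    using r(3) that unfolding disk_nbhd_def by blast
  have star: "closed_segment 0 z \<subseteq> ?U" if "z \<in> ?U" for z
    using that r assms by (intro closed_segment_subset) auto
  have "open V" using V(1) by (simp add: disk_nbhd_def)
  obtain p pz where p:
    "\<And>z. z \<in> V \<Longrightarrow> has_wirtinger (\<lambda>z. of_real (\<phi> z)) (p z) (cnj (p z)) z"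
    "\<And>z. z \<in> V \<Longrightarrow> has_wirtinger p (pz z) (of_real (laplacian \<phi> z / 4)) z"
    "continuous_on V pz"
    using C2_on_has_wirtinger[OF V(2) \<open>open V\<close>] by blast
  obtain H0 H1 where H0: "\<And>z. z \<in> ?U \<Longrightarrow> (H0 has_field_derivative H1 z) (at z)"
    "\<And>z. z \<in> ?U \<Longrightarrow> \<phi> z = Re (potential_field \<kappa> H0 H1 z)"
  proof (rule solution_potential[of r \<kappa> \<phi> p pz])
    fix z assume z: "z \<in> ?U"
    then have zV: "z \<in> V" using r by blast
    show "has_wirtinger (\<lambda>z. of_real (\<phi> z)) (p z) (cnj (p z)) z" using p(1)[OF zV] .
    have "laplacian \<phi> z / 4 = - 2 * \<kappa> * \<phi> z * (1 / (1 + \<kappa> * (cmod z)\<^sup>2))\<^sup>2"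
      using V(3)[OF zV] by (simp add: cmod_power2 power_divide)
    then have "complex_of_real (laplacian \<phi> z / 4) = - 2 * of_real \<kappa> * of_real (\<phi> z) * (conf_factor \<kappa> z)\<^sup>2"
      unfolding conf_factor_eq_of_real by (simp del: of_real_divide)
    then show "has_wirtinger p (pz z) (- 2 * of_real \<kappa> * of_real (\<phi> z) * (conf_factor \<kappa> z)\<^sup>2) z"
      using p(2)[OF zV] by (simp only:)
  qed (use w \<kappa> p(3) r in \<open>auto intro: continuous_on_subset\<close>)
  obtain G G1 where G: "G 0 = 0" "\<And>z. z \<in> ?U \<Longrightarrow> (G has_field_derivative G1 z) (at z)"
    "\<And>z. z \<in> ?U \<Longrightarrow> \<phi> z = Re (potential_field \<kappa> G G1 z)"
  proof (rule potential_vanishing_at_0[OF w \<kappa> H0(1)])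
    fix G G1
    assume "G 0 = 0" "\<And>z. z \<in> ?U \<Longrightarrow> (G has_field_derivative G1 z) (at z)"
      "\<And>z. z \<in> ?U \<Longrightarrow> Re (potential_field \<kappa> G G1 z) = Re (potential_field \<kappa> H0 H1 z)"
    then show thesis using H0(2) by (intro that[of G G1]) auto
  qed
  have hol: "G holomorphic_on ?U" using G(2) by (subst holomorphic_on_open) blast+
  have "\<exists>F. F holomorphic_on ?U \<and> (\<forall>z\<in>?U. \<phi> z = rep_formula \<kappa> F z)"
  proof (cases "\<kappa> = 1")
    case True
    have "deriv G z = G1 z" if "z \<in> ?U" for z using G(2)[OF that] by (rule DERIV_imp_deriv)
    then have "G1 holomorphic_on ?U"
      using holomorphic_deriv[OF hol open_ball] by (rule holomorphic_transform[rotated])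
    moreover have "\<phi> z = rep_formula \<kappa> G1 z" if "z \<in> ?U" for z
      using rep_formula_pos[OF G(2) G(1) star[OF that]] G(3)[OF that] True by simp
    ultimately show ?thesis by blast
  next
    case False
    then have \<kappa>': "\<kappa> = -1" using \<kappa> by simp
    define F where "F z = (if z = 0 then deriv G 0 else (G z - G 0) / (z - 0))" for z
    have F: "F holomorphic_on ?U"
      unfolding F_def [abs_def] by (rule pole_lemma_open[OF hol open_ball])
    have GF: "G z = z * F z" for z using G(1) by (simp add: F_def)
    have "\<phi> z = rep_formula \<kappa> F z" if z: "z \<in> ?U" for z
    proof -
      have "((\<lambda>z. z * F z) has_field_derivative F z + z * deriv F z) (at z)"
        using DERIV_mult[OF DERIV_ident holomorphic_derivI[OF F open_ball z]]
        by (simp add: add.commute mult.commute)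
      then have "G1 z = F z + z * deriv F z"
        using G(2)[OF z] DERIV_unique unfolding GF [abs_def] by blast
      then show ?thesis
        using rep_formula_neg[of z F] G(3)[OF z] w[OF z] by (simp add: \<kappa>' potential_field_def GF)
    qed
    then show ?thesis using F by blast
  qed
  then show ?thesis
    using r star V(4) by (intro exI[of _ "?U"] | blast)+
qed

theorem mainTheorem4:
  fixes \<rho>\<^sub>o \<kappa> :: real
  assumes "0 < \<rho>\<^sub>o" and "\<rho>\<^sub>o < 1" and "\<kappa> \<in> {1, -1}"
  shows "{\<phi> :: complex \<Rightarrow> real. solution_over_disk \<kappa> \<rho>\<^sub>o \<phi>} =
         {\<phi>. \<exists>F U. disk_nbhd \<kappa> \<rho>\<^sub>o U \<and> (\<forall>z\<in>U. closed_segment 0 z \<subseteq> U) \<and>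
                 F holomorphic_on U \<and>
                 (\<forall>z\<in>U. \<phi> z = rep_formula \<kappa> F z \<and> \<kappa> * \<phi> z < 0)}"
  using solution_representation[OF assms(3,1)] representation_solution[OF assms(3)] by blast

end
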